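(* Let an irregular LDPC code be given whose Tanner graph has no $4$-cycles and no $8$-cycle with a chord, and whose v-node degrees (column weights) lie in $\{d_1,\ldots,d_\ell\}$, where the minimum v-node degree is $d_1=\gamma$. Then every $(a,b)$ elementary trapping set of the Tanner graph with $b<a$ satisfies $a\ge 2\gamma-2$.
   Context: The Tanner graph of a code given by a binary parity-check matrix is the simple bipartite graph with variable-nodes (v-nodes, one per column) and check-nodes (c-nodes, one per row), adjacent iff the corresponding entry is $1$. An $(a,b)$ trapping set is a set of $a\ge1$ v-nodes such that, in the subgraph induced by these v-nodes and all c-nodes adjacent to at least one of them, exactly $b$ c-nodes have odd degree. It is elementary if every c-node of this induced subgraph has degree $1$ or $2$. A cycle $C$ is a cycle with a chord if some c-node outside $C$ is adjacent to two distinct v-nodes of $C$, or some edge not in $C$ joins a v-node of $C$ to a c-node of $C$; otherwise it is chordless. *)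

theory Defs
  imports
    "HOL-Library.Z2"
    "Jordan_Normal_Form.Matrix"
    "Graph_Theory.Graph_Theory"
begin

text \<open>
  Column \<open>j\<close> of the parity-check matrix is the v-node \<open>Inl j\<close>, row \<open>i\<close> the c-node \<open>Inr i\<close>.
\<close>

definition vnodes :: "bit mat \<Rightarrow> (nat + nat) set" where
  "vnodes H = Inl ` {..<dim_col H}"

definition cnodes :: "bit mat \<Rightarrow> (nat + nat) set" where
  "cnodes H = Inr ` {..<dim_row H}"

text \<open>
  Simple undirected graphs are finite symmetric loop-free digraphs without parallel arcs
  (locale \<^locale>\<open>pair_graph\<close>); an undirected edge is a pair of opposite arcs.
\<close>

definition tanner_graph :: "bit mat \<Rightarrow> (nat + nat) pair_pre_digraph" where
  "tanner_graph H =
     \<lparr> pverts = vnodes H \<union> cnodes H,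
       parcs = {(Inl j, Inr i) | i j. i < dim_row H \<and> j < dim_col H \<and> H $$ (i, j) = 1}
             \<union> {(Inr i, Inl j) | i j. i < dim_row H \<and> j < dim_col H \<and> H $$ (i, j) = 1} \<rparr>"

lemma pair_graph_tanner_graph: "pair_graph (tanner_graph H)"
proof -
  let ?A = "parcs (tanner_graph H)"
  have sub: "?A \<subseteq> (vnodes H \<union> cnodes H) \<times> (vnodes H \<union> cnodes H)"
    by (auto simp: tanner_graph_def vnodes_def cnodes_def)
  have fin: "finite (vnodes H \<union> cnodes H)"
    by (simp add: vnodes_def cnodes_def)
  have sym: "sym ?A"
    by (auto simp: tanner_graph_def sym_def)
  show ?thesis
  proof unfold_locales
    show "finite (pverts (tanner_graph H))"
      using fin by (simp add: tanner_graph_def)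
    show "finite ?A"
      using finite_subset[OF sub] fin by simp
    show "symmetric (with_proj (tanner_graph H))"
      using sym by (simp add: symmetric_def)
  qed (auto simp: tanner_graph_def vnodes_def cnodes_def)
qed

text \<open>In a symmetric digraph without parallel arcs the out-degree is the undirected degree.\<close>

abbreviation node_degree :: "('a, 'b) pre_digraph \<Rightarrow> 'a \<Rightarrow> nat" where
  "node_degree \<equiv> out_degree"

text \<open>
  The library's notion of cycle, given by the list of arcs traversed, also covers
  \<open>u \<rightarrow> v \<rightarrow> u\<close>, which is not a cycle of the undirected graph.
\<close>

definition tanner_cycle :: "bit mat \<Rightarrow> ((nat + nat) \<times> (nat + nat)) list \<Rightarrow> bool" where
  "tanner_cycle H C \<longleftrightarrow> pre_digraph.cycle (with_proj (tanner_graph H)) C \<and> length C \<ge> 3"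

definition has_chord :: "bit mat \<Rightarrow> ((nat + nat) \<times> (nat + nat)) list \<Rightarrow> bool" where
  "has_chord H C \<longleftrightarrow>
     (\<exists>c \<in> cnodes H - fst ` set C. \<exists>v \<in> vnodes H \<inter> fst ` set C. \<exists>w \<in> vnodes H \<inter> fst ` set C.
        v \<noteq> w \<and> (v, c) \<in> parcs (tanner_graph H) \<and> (w, c) \<in> parcs (tanner_graph H))
   \<or> (\<exists>v \<in> vnodes H \<inter> fst ` set C. \<exists>c \<in> cnodes H \<inter> fst ` set C.
        (v, c) \<in> parcs (tanner_graph H) \<and> (v, c) \<notin> set C \<and> (c, v) \<notin> set C)"

definition adjacent_cnodes :: "bit mat \<Rightarrow> (nat + nat) set \<Rightarrow> (nat + nat) set" where
  "adjacent_cnodes H S = {c \<in> cnodes H. \<exists>v \<in> S. (v, c) \<in> parcs (tanner_graph H)}"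

definition ts_subgraph ::
    "bit mat \<Rightarrow> (nat + nat) set \<Rightarrow> (nat + nat, (nat + nat) \<times> (nat + nat)) pre_digraph" where
  "ts_subgraph H S = with_proj (tanner_graph H) \<restriction> (S \<union> adjacent_cnodes H S)"

definition trapping_set :: "bit mat \<Rightarrow> nat \<Rightarrow> nat \<Rightarrow> (nat + nat) set \<Rightarrow> bool" where
  "trapping_set H a b S \<longleftrightarrow>
     S \<subseteq> vnodes H \<and> card S = a \<and> a \<ge> 1 \<and>
     card {c \<in> adjacent_cnodes H S. odd (node_degree (ts_subgraph H S) c)} = b"

definition elementary_trapping_set :: "bit mat \<Rightarrow> nat \<Rightarrow> nat \<Rightarrow> (nat + nat) set \<Rightarrow> bool" where
  "elementary_trapping_set H a b S \<longleftrightarrow>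
     trapping_set H a b S \<and>
     (\<forall>c \<in> adjacent_cnodes H S. node_degree (ts_subgraph H S) c \<in> {1, 2})"

end

theory Submission
  imports Defs
begin

text \<open>
  Join two v-nodes of the trapping set when they share a c-node. The c-nodes have degree at most 2
  and there are no 4-cycles, so the degree of a v-node in this graph is its degree in the Tanner
  graph minus its number of degree-one c-nodes; hence the average degree exceeds \<open>\<gamma> - 1\<close>. Two
  common neighbours of adjacent vertices would give an 8-cycle with a chord, so the ends of
  an edge have degree sum at most \<open>a + 1\<close>. Weighting vertices by their degree, some edge has degree
  sum greater than \<open>2 (\<gamma> - 1)\<close>.
\<close>

section \<open>Degree sums along the edges of a finite graph\<close>

lemma ex_edge_large_degree_sum:
  fixes N :: "'a \<Rightarrow> 'a set" and k :: int
  assumes "finite S"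
    and sub: "\<And>u. u \<in> S \<Longrightarrow> N u \<subseteq> S"
    and sym: "\<And>u v. u \<in> S \<Longrightarrow> v \<in> N u \<Longrightarrow> u \<in> N v"
    and "0 \<le> k"
    and avg: "k * int (card S) < (\<Sum>u\<in>S. int (card (N u)))"
  shows "\<exists>u\<in>S. \<exists>v\<in>N u. 2 * k < int (card (N u)) + int (card (N v))"
proof (rule ccontr)
  assume "\<not> ?thesis"
  then have le: "int (card (N u)) + int (card (N v)) - 2 * k \<le> 0" if "u \<in> S" "v \<in> N u" for u v
    using that by force
  define x where "x u = int (card (N u))" for u
  have nbrs: "N u = {v \<in> S. v \<in> N u}" if "u \<in> S" for u
    using sub[OF that] by auto
  have nbrs': "N v = {u \<in> S. v \<in> N u}" if "v \<in> S" for v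
    using sub sym that by blast
  \<comment> \<open>Double counting: by symmetry of \<open>N\<close>, the term \<open>x v\<close>
    occurs once for each of the \<open>x v\<close> neighbours of \<open>v\<close>.\<close>
  have swap: "(\<Sum>u\<in>S. \<Sum>v\<in>N u. x v) = (\<Sum>u\<in>S. x u * x u)"
  proof -
    have "(\<Sum>u\<in>S. \<Sum>v\<in>N u. x v) = (\<Sum>u\<in>S. \<Sum>v\<in>{v \<in> S. v \<in> N u}. x v)"
      using nbrs by (intro sum.cong) auto
    also have "\<dots> = (\<Sum>v\<in>S. \<Sum>u\<in>{u \<in> S. v \<in> N u}. x v)"
      using \<open>finite S\<close> by (intro sum.swap_restrict)
    also have "\<dots> = (\<Sum>v\<in>S. x v * x v)"
      using nbrs' by (intro sum.cong) (auto simp: x_def)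
    finally show ?thesis .
  qed
  \<comment> \<open>The excess over \<open>2 * k\<close> is totalled over all ordered adjacent
    pairs. By the negated claim no term is positive, so it remains to show that the total is
    positive.\<close>
  have "(\<Sum>u\<in>S. \<Sum>v\<in>N u. x u + x v - 2 * k) = 2 * (\<Sum>u\<in>S. x u * (x u - k))"
  proof -
    have "(\<Sum>u\<in>S. \<Sum>v\<in>N u. x u + x v - 2 * k)
        = (\<Sum>u\<in>S. x u * x u) + (\<Sum>u\<in>S. \<Sum>v\<in>N u. x v) - (\<Sum>u\<in>S. x u * (2 * k))"
      by (simp add: sum.distrib sum_subtractf x_def)
    then show ?thesis
      by (simp add: swap sum_subtractf sum_distrib_left algebra_simps)
  qed
  moreover have "(\<Sum>u\<in>S. \<Sum>v\<in>N u. x u + x v - 2 * k) \<le> 0"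
    unfolding x_def by (intro sum_nonpos le)
  \<comment> \<open>Expanding the square of \<open>x u - k\<close> would give only the factor
    \<open>k\<close>, and hence no strict inequality for \<open>k = 0\<close>. Integrality of the
    degrees improves it to \<open>k + 1\<close>.\<close>
  moreover have "(k + 1) * (\<Sum>u\<in>S. x u - k) \<le> (\<Sum>u\<in>S. x u * (x u - k))"
    unfolding sum_distrib_left
  proof (rule sum_mono)
    fix u
    txt \<open>A product of two consecutive integers is nonnegative.\<close>
    have "0 \<le> (x u - k) * (x u - k - 1)"
      by (cases "x u \<le> k") (auto intro: mult_nonpos_nonpos mult_nonneg_nonneg)
    then show "(k + 1) * (x u - k) \<le> x u * (x u - k)"
      by (simp add: algebra_simps)
  qed
  moreover have "0 < (k + 1) * (\<Sum>u\<in>S. x u - k)"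
    using avg \<open>0 \<le> k\<close> by (intro mult_pos_pos) (auto simp: sum_subtractf x_def mult.commute)
  ultimately show False
    by linarith
qed

text \<open>A diamond is two triangles sharing an edge. Without one, the neighbourhoods of the ends
  of an edge overlap in at most one vertex, so inclusion-exclusion bounds their degree sum by
  \<open>card S + 1\<close>. For the edge of the previous lemma this reads
  \<open>2 * k < card S + 1\<close>.\<close>

lemma diamond_free_order_lower_bound:
  fixes N :: "'a \<Rightarrow> 'a set" and k :: int
  assumes "finite S"
    and sub: "\<And>u. u \<in> S \<Longrightarrow> N u \<subseteq> S"
    and sym: "\<And>u v. u \<in> S \<Longrightarrow> v \<in> N u \<Longrightarrow> u \<in> N v"
    and diamond_free: "\<And>u v x y. \<lbrakk>u \<in> S; v \<in> N u; x \<in> N u \<inter> N v; y \<in> N u \<inter> N v\<rbrakk> \<Longrightarrow> x = y"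
    and "0 \<le> k"
    and avg: "k * int (card S) < (\<Sum>u\<in>S. int (card (N u)))"
  shows "2 * k \<le> int (card S)"
proof -
  obtain u v where uv: "u \<in> S" "v \<in> N u" "2 * k < int (card (N u)) + int (card (N v))"
    using ex_edge_large_degree_sum[OF \<open>finite S\<close> sub sym \<open>0 \<le> k\<close> avg] by blast
  have "v \<in> S"
    using uv sub by blast
  have fin: "finite (N u)" "finite (N v)"
    using finite_subset[OF sub \<open>finite S\<close>] \<open>u \<in> S\<close> \<open>v \<in> S\<close> by auto
  have "card (N u) + card (N v) = card (N u \<union> N v) + card (N u \<inter> N v)"
    by (rule card_Un_Int[OF fin])
  moreover have "card (N u \<union> N v) \<le> card S"
    using sub \<open>u \<in> S\<close> \<open>v \<in> S\<close> \<open>finite S\<close> by (intro card_mono) auto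
  moreover have "card (N u \<inter> N v) \<le> Suc 0"
    using diamond_free uv fin by (subst card_le_Suc0_iff_eq) blast+
  ultimately show ?thesis
    using uv(3) by linarith
qed

section \<open>Arcs, degrees and short cycles of the Tanner graph\<close>

lemma tanner_arc_sym: "(x, y) \<in> parcs (tanner_graph H) \<Longrightarrow> (y, x) \<in> parcs (tanner_graph H)"
  by (auto simp: tanner_graph_def)

lemma tanner_arc_from_vnode:
  "(v, c) \<in> parcs (tanner_graph H) \<Longrightarrow> v \<in> vnodes H \<Longrightarrow> c \<in> cnodes H"
  by (auto simp: tanner_graph_def vnodes_def cnodes_def)

lemma vnodes_cnodes_disjoint: "v \<in> vnodes H \<Longrightarrow> c \<in> cnodes H \<Longrightarrow> v \<noteq> c"
  by (auto simp: vnodes_def cnodes_def)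

lemma finite_tanner_nbrs: "finite {c. (v, c) \<in> parcs (tanner_graph H)}"
proof (rule finite_subset)
  show "{c. (v, c) \<in> parcs (tanner_graph H)} \<subseteq> vnodes H \<union> cnodes H"
    by (auto simp: tanner_graph_def vnodes_def cnodes_def)
  show "finite (vnodes H \<union> cnodes H)"
    by (simp add: vnodes_def cnodes_def)
qed

lemma node_degree_tanner_graph:
  "node_degree (with_proj (tanner_graph H)) v = card {c. (v, c) \<in> parcs (tanner_graph H)}"
proof -
  have "out_arcs (with_proj (tanner_graph H)) v = Pair v ` {c. (v, c) \<in> parcs (tanner_graph H)}"
    by (auto simp: out_arcs_def)
  then show ?thesis
    by (simp add: out_degree_def card_image inj_on_def)
qed

text \<open>The induced subgraph also contains c-nodes, but bipartiteness leaves \<open>c\<close>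
  only its arcs into \<open>S\<close>.\<close>

lemma node_degree_ts_subgraph:
  assumes "S \<subseteq> vnodes H" and "c \<in> adjacent_cnodes H S"
  shows "node_degree (ts_subgraph H S) c = card {v \<in> S. (v, c) \<in> parcs (tanner_graph H)}"
proof -
  have "out_arcs (ts_subgraph H S) c = Pair c ` {v \<in> S. (v, c) \<in> parcs (tanner_graph H)}"
  proof -
    have "c \<in> cnodes H"
      using assms by (simp add: adjacent_cnodes_def)
    then have "(c, c') \<notin> parcs (tanner_graph H)" if "c' \<in> adjacent_cnodes H S" for c'
      using that by (auto simp: adjacent_cnodes_def tanner_graph_def cnodes_def)
    then have "out_arcs (ts_subgraph H S) c = Pair c ` {v \<in> S. (c, v) \<in> parcs (tanner_graph H)}"
      using assms(2) by (auto simp: out_arcs_def ts_subgraph_def induce_subgraph_def)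
    moreover have "(c, v) \<in> parcs (tanner_graph H) \<longleftrightarrow> (v, c) \<in> parcs (tanner_graph H)" for v
      using tanner_arc_sym by blast
    ultimately show ?thesis
      by simp
  qed
  then show ?thesis
    by (simp add: out_degree_def card_image inj_on_def)
qed

lemma tanner_cycle_4:
  assumes "v \<in> vnodes H" "w \<in> vnodes H" "v \<noteq> w" "c \<noteq> c'"
    and "(v, c) \<in> parcs (tanner_graph H)" "(w, c) \<in> parcs (tanner_graph H)"
    and "(v, c') \<in> parcs (tanner_graph H)" "(w, c') \<in> parcs (tanner_graph H)"
  shows "tanner_cycle H [(v, c), (c, w), (w, c'), (c', v)]"
proof -
  have "v \<noteq> c" "v \<noteq> c'" "w \<noteq> c" "w \<noteq> c'"
    using assms by (metis tanner_arc_from_vnode vnodes_cnodes_disjoint)+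
  moreover have "v \<in> pverts (tanner_graph H)"
    using assms by (simp add: tanner_graph_def)
  ultimately show ?thesis
    using assms
    by (auto simp: tanner_cycle_def pre_digraph.cycle_def pre_digraph.awalk_def
        pre_digraph.cas.simps pre_digraph.awalk_verts.simps intro: tanner_arc_sym)
qed

lemma tanner_cycle_8:
  assumes V: "v1 \<in> vnodes H" "v2 \<in> vnodes H" "v3 \<in> vnodes H" "v4 \<in> vnodes H"
    and dist: "distinct [v1, v2, v3, v4]" "distinct [c1, c2, c3, c4]"
    and arcs: "(v1, c1) \<in> parcs (tanner_graph H)" "(v2, c1) \<in> parcs (tanner_graph H)"
      "(v2, c2) \<in> parcs (tanner_graph H)" "(v3, c2) \<in> parcs (tanner_graph H)"
      "(v3, c3) \<in> parcs (tanner_graph H)" "(v4, c3) \<in> parcs (tanner_graph H)"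
      "(v4, c4) \<in> parcs (tanner_graph H)" "(v1, c4) \<in> parcs (tanner_graph H)"
  shows "tanner_cycle H
    [(v1, c1), (c1, v2), (v2, c2), (c2, v3), (v3, c3), (c3, v4), (v4, c4), (c4, v1)]"
proof -
  have C: "c1 \<in> cnodes H" "c2 \<in> cnodes H" "c3 \<in> cnodes H" "c4 \<in> cnodes H"
    using V arcs tanner_arc_from_vnode by blast+
  \<comment> \<open>These are the vertices of the closed walk after its start, which must be
    distinct in a cycle; v-nodes differ from c-nodes by bipartiteness.\<close>
  then have "distinct [c1, v2, c2, v3, c3, v4, c4, v1]"
    using V dist by (auto dest: vnodes_cnodes_disjoint)
  moreover have "v1 \<in> pverts (tanner_graph H)"
    using V by (simp add: tanner_graph_def)
  ultimately show ?thesis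
    using arcs
    by (auto simp: tanner_cycle_def pre_digraph.cycle_def pre_digraph.awalk_def
        pre_digraph.cas.simps pre_digraph.awalk_verts.simps intro: tanner_arc_sym)
qed

section \<open>The graph on the v-nodes of an elementary trapping set\<close>

text \<open>Neighbourhoods in the graph that joins v-nodes sharing a c-node. The condition
  \<open>w \<noteq> v\<close> excludes the loop that any c-node at \<open>v\<close> would
  create.\<close>

definition ts_nbrs :: "bit mat \<Rightarrow> (nat + nat) set \<Rightarrow> nat + nat \<Rightarrow> (nat + nat) set" where
  "ts_nbrs H S v = {w \<in> S. w \<noteq> v \<and>
     (\<exists>c. (v, c) \<in> parcs (tanner_graph H) \<and> (w, c) \<in> parcs (tanner_graph H))}"

context
  fixes H :: "bit mat" and a b :: nat and S :: "(nat + nat) set"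
  assumes ets: "elementary_trapping_set H a b S"
    and no_4_cycle: "\<not> (\<exists>C. tanner_cycle H C \<and> length C = 4)"
    and no_8_chord: "\<not> (\<exists>C. tanner_cycle H C \<and> length C = 8 \<and> has_chord H C)"
begin

lemma ets_vnodes: "S \<subseteq> vnodes H"
  using ets by (simp add: elementary_trapping_set_def trapping_set_def)

lemma ets_finite: "finite S"
  by (rule finite_subset[OF ets_vnodes]) (simp add: vnodes_def)

lemma ets_cnode_degree:
  assumes "v \<in> S" and "(v, c) \<in> parcs (tanner_graph H)"
  shows "c \<in> adjacent_cnodes H S"
    and "card {v \<in> S. (v, c) \<in> parcs (tanner_graph H)} \<in> {1, 2}"
proof -
  show *: "c \<in> adjacent_cnodes H S"
    using assms ets_vnodes tanner_arc_from_vnode by (fastforce simp: adjacent_cnodes_def)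
  have "node_degree (ts_subgraph H S) c \<in> {1, 2}"
    using ets * unfolding elementary_trapping_set_def by blast
  then show "card {v \<in> S. (v, c) \<in> parcs (tanner_graph H)} \<in> {1, 2}"
    by (simp only: node_degree_ts_subgraph[OF ets_vnodes *])
qed

text \<open>Elementarity caps the degree of \<open>c\<close> at 2. This is what keeps the c-nodes
  chosen for different edges apart in the diamond argument.\<close>

lemma ets_no_three_at_cnode:
  assumes "u \<in> S" "v \<in> S" "w \<in> S" "distinct [u, v, w]"
    and "(u, c) \<in> parcs (tanner_graph H)" "(v, c) \<in> parcs (tanner_graph H)"
  shows "(w, c) \<notin> parcs (tanner_graph H)"
proof
  assume "(w, c) \<in> parcs (tanner_graph H)"
  then have "{u, v, w} \<subseteq> {v \<in> S. (v, c) \<in> parcs (tanner_graph H)}"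
    using assms by auto
  then have "card {u, v, w} \<le> card {v \<in> S. (v, c) \<in> parcs (tanner_graph H)}"
    using ets_finite by (intro card_mono) auto
  moreover have "card {u, v, w} = 3"
    using assms by simp
  ultimately show False
    using ets_cnode_degree(2)[of u c] assms by auto
qed

text \<open>If \<open>x\<close> and \<open>y\<close> were different, c-nodes shared along the edges
  \<open>ux\<close>, \<open>xv\<close>, \<open>vy\<close>, \<open>yu\<close> would close an 8-cycle,
  and a c-node shared by \<open>u\<close> and \<open>v\<close> would be a chord of it.\<close>

lemma ts_nbrs_diamond_free:
  assumes u: "u \<in> S" and v: "v \<in> ts_nbrs H S u"
    and x: "x \<in> ts_nbrs H S u \<inter> ts_nbrs H S v" and y: "y \<in> ts_nbrs H S u \<inter> ts_nbrs H S v"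
  shows "x = y"
proof (rule ccontr)
  assume "x \<noteq> y"
  let ?A = "parcs (tanner_graph H)"
  have S: "u \<in> S" "v \<in> S" "x \<in> S" "y \<in> S"
    and dist: "distinct [u, x, v, y]"
    using u v x y \<open>x \<noteq> y\<close> by (auto simp: ts_nbrs_def)
  obtain c1 where c1: "(u, c1) \<in> ?A" "(x, c1) \<in> ?A" using x by (auto simp: ts_nbrs_def)
  obtain c2 where c2: "(x, c2) \<in> ?A" "(v, c2) \<in> ?A" using x by (auto simp: ts_nbrs_def)
  obtain c3 where c3: "(v, c3) \<in> ?A" "(y, c3) \<in> ?A" using y by (auto simp: ts_nbrs_def)
  obtain c4 where c4: "(y, c4) \<in> ?A" "(u, c4) \<in> ?A" using y by (auto simp: ts_nbrs_def)
  obtain c5 where c5: "(u, c5) \<in> ?A" "(v, c5) \<in> ?A" using v by (auto simp: ts_nbrs_def)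
  have V: "u \<in> vnodes H" "x \<in> vnodes H" "v \<in> vnodes H" "y \<in> vnodes H"
    using S ets_vnodes by auto
  have N: "(w3, c) \<notin> ?A" if "w1 \<in> {u, x, v, y}" "w2 \<in> {u, x, v, y}" "w3 \<in> {u, x, v, y}"
    "distinct [w1, w2, w3]" "(w1, c) \<in> ?A" "(w2, c) \<in> ?A" for w1 w2 w3 c
    using that S by (intro ets_no_three_at_cnode[of w1 w2 w3]) auto
  have n1: "(v, c1) \<notin> ?A" "(y, c1) \<notin> ?A"
    using dist c1 N[of u x v c1] N[of u x y c1] by auto
  have n2: "(u, c2) \<notin> ?A" "(y, c2) \<notin> ?A"
    using dist c2 N[of x v u c2] N[of x v y c2] by auto
  have n3: "(u, c3) \<notin> ?A" "(x, c3) \<notin> ?A"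
    using dist c3 N[of v y u c3] N[of v y x c3] by auto
  have n4: "(v, c4) \<notin> ?A" "(x, c4) \<notin> ?A"
    using dist c4 N[of y u v c4] N[of y u x c4] by auto
  \<comment> \<open>Two equal c-nodes would be adjacent to a third corner. In particular each of
    \<open>c1\<close> to \<open>c4\<close> misses \<open>u\<close> or \<open>v\<close>, whereas
    \<open>c5\<close> is adjacent to both.\<close>
  have distc: "distinct [c1, c2, c3, c4]" and c5_new: "c5 \<notin> {c1, c2, c3, c4}"
    using n1 n2 n3 n4 c1 c2 c3 c4 c5 by auto
  let ?C = "[(u, c1), (c1, x), (x, c2), (c2, v), (v, c3), (c3, y), (y, c4), (c4, u)]"
  have "tanner_cycle H ?C"
    by (rule tanner_cycle_8) (use V dist distc c1 c2 c3 c4 in auto)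
  moreover have "has_chord H ?C"
  proof -
    have "c5 \<in> cnodes H"
      using c5 V tanner_arc_from_vnode by blast
    moreover have "c5 \<notin> {u, x, v, y}"
      using V \<open>c5 \<in> cnodes H\<close> by (auto dest: vnodes_cnodes_disjoint)
    ultimately have "c5 \<in> cnodes H - fst ` set ?C"
      using c5_new by auto
    moreover have "u \<in> vnodes H \<inter> fst ` set ?C" "v \<in> vnodes H \<inter> fst ` set ?C" "u \<noteq> v"
      using V dist by auto
    ultimately show ?thesis
      unfolding has_chord_def using c5 by blast
  qed
  ultimately show False
    using no_8_chord by (auto dest!: spec[of _ ?C])
qed

section \<open>Counting degrees in the trapping set\<close>

text \<open>Every c-node at \<open>v\<close> has one or two neighbours in \<open>S\<close>. Sending
  those with two to their other neighbour is injective, since a collision would close a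
  4-cycle.\<close>

lemma ets_degree_le:
  assumes "v \<in> S"
  shows "card {c. (v, c) \<in> parcs (tanner_graph H)} \<le> card (ts_nbrs H S v)
    + card {c. (v, c) \<in> parcs (tanner_graph H) \<and>
        card {w \<in> S. (w, c) \<in> parcs (tanner_graph H)} = 1}"
proof -
  let ?A = "parcs (tanner_graph H)"
  let ?T = "\<lambda>c. {w \<in> S. (w, c) \<in> ?A}"
  let ?D = "\<lambda>n. {c. (v, c) \<in> ?A \<and> card (?T c) = n}"
  have "{c. (v, c) \<in> ?A} = ?D 1 \<union> ?D 2"
    using ets_cnode_degree(2)[OF assms] by blast
  then have "card {c. (v, c) \<in> ?A} \<le> card (?D 1) + card (?D 2)"
    by (simp only: card_Un_le)
  moreover have "card (?D 2) \<le> card (ts_nbrs H S v)"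
  proof -
    have "\<exists>w \<in> ts_nbrs H S v. (w, c) \<in> ?A" if "c \<in> ?D 2" for c
    proof -
      have "card (?T c) = 2" "(v, c) \<in> ?A"
        using that by auto
      \<comment> \<open>Two v-nodes of \<open>S\<close> at \<open>c\<close> cannot both be
        \<open>v\<close>; the other one becomes the value of \<open>f\<close> at
        \<open>c\<close>.\<close>
      then have "\<not> ?T c \<subseteq> {v}"
        using card_mono[of "{v}" "?T c"] by auto
      then show ?thesis
        using \<open>(v, c) \<in> ?A\<close> by (auto simp: ts_nbrs_def)
    qed
    then have "\<forall>c \<in> ?D 2. \<exists>w. w \<in> ts_nbrs H S v \<and> (w, c) \<in> ?A"
      by blast
    from bchoice[OF this] obtain f where
      f: "\<And>c. c \<in> ?D 2 \<Longrightarrow> f c \<in> ts_nbrs H S v \<and> (f c, c) \<in> ?A"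
      by blast
    have "inj_on f (?D 2)"
    proof (rule inj_onI, rule ccontr)
      fix c c' assume *: "c \<in> ?D 2" "c' \<in> ?D 2" "f c = f c'" "c \<noteq> c'"
      have "f c \<in> S" "f c \<noteq> v"
        using f[OF *(1)] by (auto simp: ts_nbrs_def)
      then have "tanner_cycle H [(v, c), (c, f c), (f c, c'), (c', v)]"
        using * f[OF *(1)] f[OF *(2)] assms ets_vnodes by (intro tanner_cycle_4) auto
      then show False
        using no_4_cycle by fastforce
    qed
    moreover have "f ` ?D 2 \<subseteq> ts_nbrs H S v"
      using f by blast
    moreover have "finite (ts_nbrs H S v)"
      using ets_finite by (simp add: ts_nbrs_def)
    ultimately show ?thesis
      by (rule card_inj_on_le)
  qed
  ultimately show ?thesis
    by linarith
qed

text \<open>A c-node with a single neighbour in \<open>S\<close> is counted only at that neighbour,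
  so the sum counts distinct c-nodes. Their degree 1 is odd, so they are among the \<open>b\<close>
  odd ones.\<close>

lemma ets_sum_degree_one_le:
  "(\<Sum>v\<in>S. card {c. (v, c) \<in> parcs (tanner_graph H) \<and>
     card {w \<in> S. (w, c) \<in> parcs (tanner_graph H)} = 1}) \<le> b"
proof -
  let ?A = "parcs (tanner_graph H)"
  let ?D = "\<lambda>v. {c. (v, c) \<in> ?A \<and> card {w \<in> S. (w, c) \<in> ?A} = 1}"
  let ?B = "{c \<in> adjacent_cnodes H S. odd (node_degree (ts_subgraph H S) c)}"
  have fin: "finite (?D v)" for v
    using finite_tanner_nbrs by (rule rev_finite_subset) auto
  have "(\<Sum>v\<in>S. card (?D v)) = card (\<Union>v\<in>S. ?D v)"
  proof (rule card_UN_disjoint[symmetric])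
    show "\<forall>i\<in>S. \<forall>j\<in>S. i \<noteq> j \<longrightarrow> ?D i \<inter> ?D j = {}"
    proof (intro ballI impI, rule ccontr)
      fix i j assume ij: "i \<in> S" "j \<in> S" "i \<noteq> j" and "?D i \<inter> ?D j \<noteq> {}"
      then obtain c where c: "(i, c) \<in> ?A" "(j, c) \<in> ?A" "card {w \<in> S. (w, c) \<in> ?A} = 1"
        by blast
      then obtain w where "{w \<in> S. (w, c) \<in> ?A} = {w}"
        using card_1_singletonE by blast
      then have "i = w" "j = w"
        using ij c by blast+
      then show False
        using \<open>i \<noteq> j\<close> by simp
    qed
  qed (use ets_finite fin in auto)
  also have "\<dots> \<le> card ?B"
  proof (rule card_mono)
    show "finite ?B"
      by (rule finite_subset[of _ "cnodes H"]) (auto simp: adjacent_cnodes_def cnodes_def)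
    show "(\<Union>v\<in>S. ?D v) \<subseteq> ?B"
      using ets_cnode_degree(1) node_degree_ts_subgraph[OF ets_vnodes] by fastforce
  qed
  also have "\<dots> = b"
    using ets by (simp add: elementary_trapping_set_def trapping_set_def)
  finally show ?thesis .
qed

lemma ets_size_lower_bound:
  assumes min_deg: "\<And>v. v \<in> S \<Longrightarrow> g \<le> node_degree (with_proj (tanner_graph H)) v"
    and "b < a"
  shows "2 * int g - 2 \<le> int a"
\<comment> \<open>The graph bound is applied with \<open>k = int g - 1\<close>, which is nonnegative
  only for positive \<open>g\<close>; for \<open>g = 0\<close> the claimed lower bound is
  negative.\<close>
proof (cases "g = 0")
  case False
  have card_S: "card S = a"
    using ets by (simp add: elementary_trapping_set_def trapping_set_def)
  let ?A = "parcs (tanner_graph H)"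
  let ?d1 = "\<lambda>v. card {c. (v, c) \<in> ?A \<and> card {w \<in> S. (w, c) \<in> ?A} = 1}"
  have "card S * g \<le> (\<Sum>v\<in>S. card (ts_nbrs H S v) + ?d1 v)"
    using sum_mono[of S "\<lambda>_. g" "\<lambda>v. card (ts_nbrs H S v) + ?d1 v"]
      min_deg ets_degree_le by (fastforce simp: node_degree_tanner_graph)
  also have "\<dots> \<le> (\<Sum>v\<in>S. card (ts_nbrs H S v)) + b"
    using ets_sum_degree_one_le by (simp add: sum.distrib)
  finally have "int a * int g \<le> (\<Sum>v\<in>S. int (card (ts_nbrs H S v))) + int b"
    unfolding card_S by (metis of_nat_add of_nat_le_iff of_nat_mult of_nat_sum)
  \<comment> \<open>Here \<open>b < a\<close> enters: replacing \<open>b\<close> by the larger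
    \<open>a\<close> makes the inequality strict and lowers the factor from \<open>g\<close> to
    \<open>g - 1\<close>.\<close>
  then have avg: "(int g - 1) * int (card S) < (\<Sum>v\<in>S. int (card (ts_nbrs H S v)))"
    using \<open>b < a\<close> by (simp add: card_S algebra_simps)
  have "2 * (int g - 1) \<le> int (card S)"
  proof (rule diamond_free_order_lower_bound[OF ets_finite _ _ ts_nbrs_diamond_free _ avg])
    show "ts_nbrs H S u \<subseteq> S" for u
      by (auto simp: ts_nbrs_def)
    show "u \<in> ts_nbrs H S v" if "u \<in> S" "v \<in> ts_nbrs H S u" for u v
      using that by (auto simp: ts_nbrs_def)
  qed (use False in auto)
  then show ?thesis
    by (simp add: card_S)
qed simp

end

theorem theorem3:
  fixes H :: "bit mat" and d :: "nat \<Rightarrow> nat" and l \<gamma> a b :: nat and S :: "(nat + nat) set"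
  assumes "l \<ge> 1"
    and "\<forall>v \<in> vnodes H. node_degree (with_proj (tanner_graph H)) v \<in> d ` {1..l}"
    and "d 1 = Min (node_degree (with_proj (tanner_graph H)) ` vnodes H)"
    and "d 1 = \<gamma>"
    and "\<not> (\<exists>C. tanner_cycle H C \<and> length C = 4)"
    and "\<not> (\<exists>C. tanner_cycle H C \<and> length C = 8 \<and> has_chord H C)"
    and "elementary_trapping_set H a b S"
    and "b < a"
  shows "int a \<ge> 2 * int \<gamma> - 2"
proof -
  \<comment> \<open>The minimum over all v-nodes bounds the degrees in \<open>S\<close>, and these
    are degrees in the whole Tanner graph.\<close>
  have "\<gamma> \<le> node_degree (with_proj (tanner_graph H)) v" if "v \<in> S" for v
  proof -
    have "v \<in> vnodes H"
      using ets_vnodes[OF assms(7,5,6)] that by blast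
    moreover have "finite (vnodes H)"
      by (simp add: vnodes_def)
    ultimately show ?thesis
      unfolding assms(4)[symmetric] assms(3) by (intro Min_le) auto
  qed
  then show ?thesis
    using ets_size_lower_bound[OF assms(7,5,6)] \<open>b < a\<close> by blast
qed

end
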